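(* Let $(\bm{u}_h^{n},\bm{B}_h^{n})_{n\ge 0}$, together with the midpoint variables $(\bm{\omega}_h^{n+1/2},\bm{j}_h^{n+1/2},\bm{E}_h^{n+1/2},\bm{H}_h^{n+1/2},P_h^{n+1/2})_{n\ge 0}$, be any solution of the fully discrete MHD scheme (a)–(g) described in the context. If the initial data satisfies $\nabla\cdot\bm{B}_h^{0}=0$, then $$\nabla\cdot \bm{B}_h^{n}=0\qquad \text{for all } n\ge 0 .$$
   Context: $\Omega\subset\mathbb{R}^3$ is a contractible bounded Lipschitz domain with unit outer normal $\bm{n}$; $(\cdot,\cdot)$ and $\|\cdot\|$ are the $L^2(\Omega)$ inner product and norm. $H_0(\mathrm{grad},\Omega)$, $H_0(\mathrm{curl},\Omega)$, $H_0(\mathrm{div},\Omega)$ are the usual spaces of $L^2$ fields with $L^2$ gradient/curl/divergence and vanishing trace $v$, $v\times \bm{n}$, $v\cdot\bm{n}$ on $\partial\Omega$, respectively; $L^2_0(\Omega)$ is the space of mean-zero $L^2$ functions. $H_0^h(\mathrm{grad},\Omega)$, $H_0^h(\mathrm{curl},\Omega)$, $H_0^h(\mathrm{div},\Omega)$, $L_0^{2,h}(\Omega)$ are finite-dimensional (piecewise polynomial finite element) subspaces of these spaces forming a discrete de Rham complex $$0\to H_0^h(\mathrm{grad},\Omega)\xrightarrow{\mathrm{grad}} H_0^h(\mathrm{curl},\Omega)\xrightarrow{\mathrm{curl}} H_0^h(\mathrm{div},\Omega)\xrightarrow{\mathrm{div}} L_0^{2,h}(\Omega)\to 0,$$ which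 is exact. Scheme. Let $\Delta t>0$ be the time step, $\mathsf{c}>0$ the coupling number, $R_e,R_m\in(0,\infty]$ the fluid and magnetic Reynolds numbers (with $R^{-1}=0$ when $R=\infty$), and $\bm{f}\in [L^2(\Omega)]^3$ a given source (evaluated at the midpoint of each time interval). Given $(\bm{u}_h^0,\bm{B}_h^0)\in H_0^h(\mathrm{curl},\Omega)\times H_0^h(\mathrm{div},\Omega)$, for $n=0,1,2,\dots$ one seeks $\bm{u}_h^{n+1},\bm{\omega}_h^{n+1/2},\bm{j}_h^{n+1/2},\bm{E}_h^{n+1/2},\bm{H}_h^{n+1/2}\in H_0^h(\mathrm{curl},\Omega)$, $\bm{B}_h^{n+1}\in H_0^h(\mathrm{div},\Omega)$, $P_h^{n+1/2}\in H_0^h(\mathrm{grad},\Omega)$ such that for all $\bm{v}_h,\bm{\mu}_h,\bm{k}_h,\bm{F}_h,\bm{G}_h\in H_0^h(\mathrm{curl},\Omega)$, $\bm{C}_h\in H_0^h(\mathrm{div},\Omega)$, $Q_h\in H_0^h(\mathrm{grad},\Omega)$: (a) $(D_t\bm{u}_h,\bm{v}_h)-(\bm{u}_h\times\bm{\omega}_h,\bm{v}_h)+R_e^{-1}(\nabla\times\bm{u}_h,\nabla\times\bm{v}_h)+(\nabla P_h,\bm{v}_h)-\mathsf{c}(\bm{j}_h\times\bm{H}_h,\bm{v}_h)=(\bm{f},\bm{v}_h)$; (b) $(D_t\bm{B}_h,\bm{C}_h)+(\nabla\times\bm{E}_h,\bm{C}_h)=0$; (c) $(R_m^{-1}\bm{j}_h-[\bm{E}_h+\bm{u}_h\times\bm{H}_h],\bm{G}_h)=0$;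 (d) $(\bm{\omega}_h,\bm{\mu}_h)-(\nabla\times\bm{u}_h,\bm{\mu}_h)=0$; (e) $(\bm{j}_h,\bm{k}_h)-(\bm{B}_h,\nabla\times\bm{k}_h)=0$; (f) $(\bm{B}_h,\bm{F}_h)-(\bm{H}_h,\bm{F}_h)=0$; (g) $(\bm{u}_h,\nabla Q_h)=0$. Here $D_t\bm{u}_h=(\bm{u}_h^{n+1}-\bm{u}_h^n)/\Delta t$, $D_t\bm{B}_h=(\bm{B}_h^{n+1}-\bm{B}_h^n)/\Delta t$, $\bm{u}_h=(\bm{u}_h^{n+1}+\bm{u}_h^n)/2$, $\bm{B}_h=(\bm{B}_h^{n+1}+\bm{B}_h^n)/2$, and $\bm{\omega}_h,\bm{j}_h,\bm{E}_h,\bm{H}_h,P_h$ denote the midpoint unknowns with superscript $n+1/2$. *)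

theory Defs
  imports "HOL-Analysis.Analysis"
begin

text \<open>
  Elements of \<open>L\<^sup>2(\<Omega>)\<close> are represented by functions on the whole of \<open>\<real>\<^sup>3\<close> of which only the
  values almost everywhere on \<open>\<Omega>\<close> matter; equality of such elements is \<open>AE\<close> equality with respect to
  \<open>lebesgue_on \<Omega>\<close>, i.e. \<open>ae_eq\<close> below.
\<close>

type_synonym R3 = "real^3"


section \<open>Lipschitz domains\<close>

text \<open>
  Near each boundary point the domain is, in suitable orthonormal coordinates \<open>A x\<close>, the part of a
  neighbourhood lying strictly above the graph of a Lipschitz function. The function may be taken
  on all of the plane (Lipschitz functions extend), and the origin of the coordinates
  need not be moved (a translation is absorbed in \<open>g\<close>).
\<close>

definition lipschitz_domain :: "R3 set \<Rightarrow> bool" where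
  "lipschitz_domain \<Omega> \<longleftrightarrow>
     open \<Omega> \<and> connected \<Omega> \<and> \<Omega> \<noteq> {} \<and>
     (\<forall>p\<in>frontier \<Omega>. \<exists>U A (g :: real^2 \<Rightarrow> real) L.
        open U \<and> p \<in> U \<and> orthogonal_transformation (A :: R3 \<Rightarrow> R3) \<and> L-lipschitz_on UNIV g \<and>
        \<Omega> \<inter> U = {x \<in> U. g (vector [A x $ 1, A x $ 2]) < A x $ 3})"


section \<open>Smooth functions and classical differential operators\<close>

definition partial :: "3 \<Rightarrow> (R3 \<Rightarrow> real) \<Rightarrow> R3 \<Rightarrow> real" where
  "partial i \<phi> x = frechet_derivative \<phi> (at x) (axis i 1)"

definition grad :: "(R3 \<Rightarrow> real) \<Rightarrow> R3 \<Rightarrow> R3" where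
  "grad \<phi> x = (\<chi> i. partial i \<phi> x)"

definition curl :: "(R3 \<Rightarrow> R3) \<Rightarrow> R3 \<Rightarrow> R3" where
  "curl \<phi> x = vector
     [partial 2 (\<lambda>y. \<phi> y $ 3) x - partial 3 (\<lambda>y. \<phi> y $ 2) x,
      partial 3 (\<lambda>y. \<phi> y $ 1) x - partial 1 (\<lambda>y. \<phi> y $ 3) x,
      partial 1 (\<lambda>y. \<phi> y $ 2) x - partial 2 (\<lambda>y. \<phi> y $ 1) x]"

definition divergence :: "(R3 \<Rightarrow> R3) \<Rightarrow> R3 \<Rightarrow> real" where
  "divergence \<phi> x = (\<Sum>i\<in>UNIV. partial i (\<lambda>y. \<phi> y $ i) x)"

primrec Ck :: "nat \<Rightarrow> ('a::real_normed_vector \<Rightarrow> 'b::real_normed_vector) \<Rightarrow> bool" where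
  "Ck 0 f \<longleftrightarrow> continuous_on UNIV f"
| "Ck (Suc k) f \<longleftrightarrow>
     (\<forall>x. f differentiable at x) \<and> (\<forall>v. Ck k (\<lambda>x. frechet_derivative f (at x) v))"

definition smooth :: "('a::real_normed_vector \<Rightarrow> 'b::real_normed_vector) \<Rightarrow> bool" where
  "smooth f \<longleftrightarrow> (\<forall>k. Ck k f)"

definition test_function :: "R3 set \<Rightarrow> (R3 \<Rightarrow> 'b::real_normed_vector) \<Rightarrow> bool" where
  "test_function \<Omega> \<phi> \<longleftrightarrow>
     smooth \<phi> \<and> compact (closure {x. \<phi> x \<noteq> 0}) \<and> closure {x. \<phi> x \<noteq> 0} \<subseteq> \<Omega>"


section \<open>Square integrable fields and weak derivatives\<close>

definition L2 :: "R3 set \<Rightarrow> (R3 \<Rightarrow> 'b::euclidean_space) set" where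
  "L2 \<Omega> = {f. f \<in> borel_measurable (lebesgue_on \<Omega>) \<and>
              integrable (lebesgue_on \<Omega>) (\<lambda>x. (norm (f x))\<^sup>2)}"

definition ip :: "R3 set \<Rightarrow> (R3 \<Rightarrow> 'b::euclidean_space) \<Rightarrow> (R3 \<Rightarrow> 'b) \<Rightarrow> real" where
  "ip \<Omega> f g = (LINT x|lebesgue_on \<Omega>. f x \<bullet> g x)"

definition ae_eq :: "R3 set \<Rightarrow> (R3 \<Rightarrow> 'b::euclidean_space) \<Rightarrow> (R3 \<Rightarrow> 'b) \<Rightarrow> bool" where
  "ae_eq \<Omega> f g \<longleftrightarrow> (AE x in lebesgue_on \<Omega>. f x = g x)"

definition has_weak_grad :: "R3 set \<Rightarrow> (R3 \<Rightarrow> real) \<Rightarrow> (R3 \<Rightarrow> R3) \<Rightarrow> bool" where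
  "has_weak_grad \<Omega> v g \<longleftrightarrow>
     (\<forall>\<phi>. test_function \<Omega> \<phi> \<longrightarrow> ip \<Omega> g \<phi> = - ip \<Omega> v (divergence \<phi>))"

definition has_weak_curl :: "R3 set \<Rightarrow> (R3 \<Rightarrow> R3) \<Rightarrow> (R3 \<Rightarrow> R3) \<Rightarrow> bool" where
  "has_weak_curl \<Omega> u w \<longleftrightarrow>
     (\<forall>\<phi>. test_function \<Omega> \<phi> \<longrightarrow> ip \<Omega> w \<phi> = ip \<Omega> u (curl \<phi>))"

definition has_weak_div :: "R3 set \<Rightarrow> (R3 \<Rightarrow> R3) \<Rightarrow> (R3 \<Rightarrow> real) \<Rightarrow> bool" where
  "has_weak_div \<Omega> u d \<longleftrightarrow>
     (\<forall>\<phi>. test_function \<Omega> \<phi> \<longrightarrow> ip \<Omega> d \<phi> = - ip \<Omega> u (grad \<phi>))"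

definition H_grad :: "R3 set \<Rightarrow> (R3 \<Rightarrow> real) set" where
  "H_grad \<Omega> = {v \<in> L2 \<Omega>. \<exists>g\<in>L2 \<Omega>. has_weak_grad \<Omega> v g}"

definition H_curl :: "R3 set \<Rightarrow> (R3 \<Rightarrow> R3) set" where
  "H_curl \<Omega> = {u \<in> L2 \<Omega>. \<exists>w\<in>L2 \<Omega>. has_weak_curl \<Omega> u w}"

definition H_div :: "R3 set \<Rightarrow> (R3 \<Rightarrow> R3) set" where
  "H_div \<Omega> = {u \<in> L2 \<Omega>. \<exists>d\<in>L2 \<Omega>. has_weak_div \<Omega> u d}"

text \<open>
  The weak derivatives are determined up to \<open>ae_eq\<close>; a representative is chosen. These
  operators are meaningful on \<open>H_grad\<close>, \<open>H_curl\<close> and \<open>H_div\<close> only.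
\<close>

definition weak_grad :: "R3 set \<Rightarrow> (R3 \<Rightarrow> real) \<Rightarrow> R3 \<Rightarrow> R3" where
  "weak_grad \<Omega> v = (SOME g. g \<in> L2 \<Omega> \<and> has_weak_grad \<Omega> v g)"

definition weak_curl :: "R3 set \<Rightarrow> (R3 \<Rightarrow> R3) \<Rightarrow> R3 \<Rightarrow> R3" where
  "weak_curl \<Omega> u = (SOME w. w \<in> L2 \<Omega> \<and> has_weak_curl \<Omega> u w)"

definition weak_div :: "R3 set \<Rightarrow> (R3 \<Rightarrow> R3) \<Rightarrow> R3 \<Rightarrow> real" where
  "weak_div \<Omega> u = (SOME d. d \<in> L2 \<Omega> \<and> has_weak_div \<Omega> u d)"


section \<open>Traces and the spaces with vanishing trace\<close>

text \<open>
  The traces are the functionals given by Green's formulas on (restrictions to \<open>\<Omega>\<close> of) smooth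
  functions on \<open>\<real>\<^sup>3\<close>. For fields smooth up to the boundary they are the boundary integrals of
  \<open>v n \<bullet> \<phi>\<close>, \<open>(u \<times> n) \<bullet> \<phi>\<close> and \<open>(u \<bullet> n) \<phi>\<close>, respectively, with \<open>n\<close> the unit outer normal.
  As \<open>n\<close> has length one, the first of them vanishes for all \<open>\<phi>\<close> iff \<open>v\<close> has trace zero.
\<close>

definition grad_trace :: "R3 set \<Rightarrow> (R3 \<Rightarrow> real) \<Rightarrow> (R3 \<Rightarrow> R3) \<Rightarrow> real" where
  "grad_trace \<Omega> v \<phi> = ip \<Omega> (weak_grad \<Omega> v) \<phi> + ip \<Omega> v (divergence \<phi>)"

definition tangential_trace :: "R3 set \<Rightarrow> (R3 \<Rightarrow> R3) \<Rightarrow> (R3 \<Rightarrow> R3) \<Rightarrow> real" where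
  "tangential_trace \<Omega> u \<phi> = ip \<Omega> u (curl \<phi>) - ip \<Omega> (weak_curl \<Omega> u) \<phi>"

definition normal_trace :: "R3 set \<Rightarrow> (R3 \<Rightarrow> R3) \<Rightarrow> (R3 \<Rightarrow> real) \<Rightarrow> real" where
  "normal_trace \<Omega> u \<phi> = ip \<Omega> (weak_div \<Omega> u) \<phi> + ip \<Omega> u (grad \<phi>)"

definition H0_grad :: "R3 set \<Rightarrow> (R3 \<Rightarrow> real) set" where
  "H0_grad \<Omega> = {v \<in> H_grad \<Omega>. \<forall>\<phi>. smooth \<phi> \<longrightarrow> grad_trace \<Omega> v \<phi> = 0}"

definition H0_curl :: "R3 set \<Rightarrow> (R3 \<Rightarrow> R3) set" where
  "H0_curl \<Omega> = {u \<in> H_curl \<Omega>. \<forall>\<phi>. smooth \<phi> \<longrightarrow> tangential_trace \<Omega> u \<phi> = 0}"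

definition H0_div :: "R3 set \<Rightarrow> (R3 \<Rightarrow> R3) set" where
  "H0_div \<Omega> = {u \<in> H_div \<Omega>. \<forall>\<phi>. smooth \<phi> \<longrightarrow> normal_trace \<Omega> u \<phi> = 0}"

definition L2_0 :: "R3 set \<Rightarrow> (R3 \<Rightarrow> real) set" where
  "L2_0 \<Omega> = {q \<in> L2 \<Omega>. (LINT x|lebesgue_on \<Omega>. q x) = 0}"


section \<open>Finite element spaces and the discrete de Rham complex\<close>

text \<open>No shape is prescribed for the cells; tetrahedral and hexahedral meshes are included.\<close>

definition mesh :: "R3 set \<Rightarrow> R3 set set \<Rightarrow> bool" where
  "mesh \<Omega> \<T> \<longleftrightarrow> finite \<T> \<and> (\<forall>T\<in>\<T>. open T \<and> T \<subseteq> \<Omega>) \<and> disjoint \<T> \<and> negligible (\<Omega> - \<Union>\<T>)"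

definition piecewise_polynomial :: "R3 set set \<Rightarrow> (R3 \<Rightarrow> 'b::euclidean_space) \<Rightarrow> bool" where
  "piecewise_polynomial \<T> v \<longleftrightarrow> (\<forall>T\<in>\<T>. \<exists>p. polynomial_function p \<and> ae_eq T v p)"

text \<open>
  A finite-dimensional subspace of \<open>W\<close> consisting of piecewise polynomials. The set \<open>V\<close> contains
  all representatives of its elements, and finite dimension refers to the classes modulo \<open>ae_eq\<close>.
\<close>

definition fe_space ::
  "R3 set \<Rightarrow> R3 set set \<Rightarrow> (R3 \<Rightarrow> 'b::euclidean_space) set \<Rightarrow> (R3 \<Rightarrow> 'b) set \<Rightarrow> bool" where
  "fe_space \<Omega> \<T> W V \<longleftrightarrow>
     V \<subseteq> W \<and>
     (\<lambda>x. 0) \<in> V \<and>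
     (\<forall>u\<in>V. \<forall>v\<in>V. (\<lambda>x. u x + v x) \<in> V) \<and>
     (\<forall>a. \<forall>v\<in>V. (\<lambda>x. a *\<^sub>R v x) \<in> V) \<and>
     (\<forall>u\<in>V. \<forall>v. ae_eq \<Omega> u v \<longrightarrow> v \<in> V) \<and>
     (\<exists>S. finite S \<and> S \<subseteq> V \<and> (\<forall>v\<in>V. \<exists>c. ae_eq \<Omega> v (\<lambda>x. \<Sum>s\<in>S. c s *\<^sub>R s x))) \<and>
     (\<forall>v\<in>V. piecewise_polynomial \<T> v)"

definition exact_discrete_de_rham ::
  "R3 set \<Rightarrow> R3 set set \<Rightarrow> (R3 \<Rightarrow> real) set \<Rightarrow> (R3 \<Rightarrow> R3) set \<Rightarrow> (R3 \<Rightarrow> R3) set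
    \<Rightarrow> (R3 \<Rightarrow> real) set \<Rightarrow> bool" where
  "exact_discrete_de_rham \<Omega> \<T> Vgrad Vcurl Vdiv V0 \<longleftrightarrow>
     fe_space \<Omega> \<T> (H0_grad \<Omega>) Vgrad \<and> fe_space \<Omega> \<T> (H0_curl \<Omega>) Vcurl \<and>
     fe_space \<Omega> \<T> (H0_div \<Omega>) Vdiv \<and> fe_space \<Omega> \<T> (L2_0 \<Omega>) V0 \<and>
     (\<forall>q\<in>Vgrad. weak_grad \<Omega> q \<in> Vcurl) \<and>
     (\<forall>u\<in>Vcurl. weak_curl \<Omega> u \<in> Vdiv) \<and>
     (\<forall>w\<in>Vdiv. weak_div \<Omega> w \<in> V0) \<and>
     (\<forall>q\<in>Vgrad. ae_eq \<Omega> (weak_grad \<Omega> q) (\<lambda>x. 0) \<longrightarrow> ae_eq \<Omega> q (\<lambda>x. 0)) \<and>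
     (\<forall>u\<in>Vcurl. ae_eq \<Omega> (weak_curl \<Omega> u) (\<lambda>x. 0) \<longleftrightarrow> (\<exists>q\<in>Vgrad. ae_eq \<Omega> u (weak_grad \<Omega> q))) \<and>
     (\<forall>w\<in>Vdiv. ae_eq \<Omega> (weak_div \<Omega> w) (\<lambda>x. 0) \<longleftrightarrow> (\<exists>u\<in>Vcurl. ae_eq \<Omega> w (weak_curl \<Omega> u))) \<and>
     (\<forall>q\<in>V0. \<exists>w\<in>Vdiv. ae_eq \<Omega> q (weak_div \<Omega> w))"


section \<open>The fully discrete MHD scheme\<close>

text \<open>
  The index \<open>n\<close> of \<open>\<omega>\<close>, \<open>j\<close>, \<open>E\<close>, \<open>H\<close>, \<open>P\<close> stands for the superscript \<open>n + 1/2\<close>. The Reynolds numbers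
  are extended reals, and \<open>inverse \<infinity> = 0\<close> there. The source at time \<open>t\<close> is \<open>f t\<close>.
\<close>

definition mhd_step ::
  "R3 set \<Rightarrow> (R3 \<Rightarrow> real) set \<Rightarrow> (R3 \<Rightarrow> R3) set \<Rightarrow> (R3 \<Rightarrow> R3) set
    \<Rightarrow> real \<Rightarrow> real \<Rightarrow> ereal \<Rightarrow> ereal \<Rightarrow> (R3 \<Rightarrow> R3)
    \<Rightarrow> (R3 \<Rightarrow> R3) \<Rightarrow> (R3 \<Rightarrow> R3) \<Rightarrow> (R3 \<Rightarrow> R3) \<Rightarrow> (R3 \<Rightarrow> R3)
    \<Rightarrow> (R3 \<Rightarrow> R3) \<Rightarrow> (R3 \<Rightarrow> R3) \<Rightarrow> (R3 \<Rightarrow> R3) \<Rightarrow> (R3 \<Rightarrow> R3) \<Rightarrow> (R3 \<Rightarrow> real) \<Rightarrow> bool" where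
  "mhd_step \<Omega> Vgrad Vcurl Vdiv \<Delta>t c R\<^sub>e R\<^sub>m f u0 u1 B0 B1 \<omega> j E H P \<longleftrightarrow>
    (let Dtu = (\<lambda>x. (u1 x - u0 x) /\<^sub>R \<Delta>t);
         DtB = (\<lambda>x. (B1 x - B0 x) /\<^sub>R \<Delta>t);
         u = (\<lambda>x. (u1 x + u0 x) /\<^sub>R 2);
         B = (\<lambda>x. (B1 x + B0 x) /\<^sub>R 2);
         Re_inv = real_of_ereal (inverse R\<^sub>e);
         Rm_inv = real_of_ereal (inverse R\<^sub>m)
     in
      (\<forall>v\<in>Vcurl.
         ip \<Omega> Dtu v - ip \<Omega> (\<lambda>x. cross3 (u x) (\<omega> x)) v
           + Re_inv * ip \<Omega> (weak_curl \<Omega> u) (weak_curl \<Omega> v)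
           + ip \<Omega> (weak_grad \<Omega> P) v - c * ip \<Omega> (\<lambda>x. cross3 (j x) (H x)) v
         = ip \<Omega> f v) \<and>
      (\<forall>C\<in>Vdiv. ip \<Omega> DtB C + ip \<Omega> (weak_curl \<Omega> E) C = 0) \<and>
      (\<forall>G\<in>Vcurl. ip \<Omega> (\<lambda>x. Rm_inv *\<^sub>R j x - (E x + cross3 (u x) (H x))) G = 0) \<and>
      (\<forall>\<mu>\<in>Vcurl. ip \<Omega> \<omega> \<mu> - ip \<Omega> (weak_curl \<Omega> u) \<mu> = 0) \<and>
      (\<forall>k\<in>Vcurl. ip \<Omega> j k - ip \<Omega> B (weak_curl \<Omega> k) = 0) \<and>
      (\<forall>F\<in>Vcurl. ip \<Omega> B F - ip \<Omega> H F = 0) \<and>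
      (\<forall>Q\<in>Vgrad. ip \<Omega> u (weak_grad \<Omega> Q) = 0))"

definition mhd_solution ::
  "R3 set \<Rightarrow> (R3 \<Rightarrow> real) set \<Rightarrow> (R3 \<Rightarrow> R3) set \<Rightarrow> (R3 \<Rightarrow> R3) set
    \<Rightarrow> real \<Rightarrow> real \<Rightarrow> ereal \<Rightarrow> ereal \<Rightarrow> (real \<Rightarrow> R3 \<Rightarrow> R3)
    \<Rightarrow> (nat \<Rightarrow> R3 \<Rightarrow> R3) \<Rightarrow> (nat \<Rightarrow> R3 \<Rightarrow> R3)
    \<Rightarrow> (nat \<Rightarrow> R3 \<Rightarrow> R3) \<Rightarrow> (nat \<Rightarrow> R3 \<Rightarrow> R3) \<Rightarrow> (nat \<Rightarrow> R3 \<Rightarrow> R3) \<Rightarrow> (nat \<Rightarrow> R3 \<Rightarrow> R3)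
    \<Rightarrow> (nat \<Rightarrow> R3 \<Rightarrow> real) \<Rightarrow> bool" where
  "mhd_solution \<Omega> Vgrad Vcurl Vdiv \<Delta>t c R\<^sub>e R\<^sub>m f u B \<omega> j E H P \<longleftrightarrow>
     (\<forall>n. u n \<in> Vcurl \<and> B n \<in> Vdiv \<and>
          \<omega> n \<in> Vcurl \<and> j n \<in> Vcurl \<and> E n \<in> Vcurl \<and> H n \<in> Vcurl \<and> P n \<in> Vgrad \<and>
          mhd_step \<Omega> Vgrad Vcurl Vdiv \<Delta>t c R\<^sub>e R\<^sub>m (f ((real n + 1/2) * \<Delta>t))
            (u n) (u (Suc n)) (B n) (B (Suc n)) (\<omega> n) (j n) (E n) (H n) (P n))"

end

theory Submission
  imports Defs
begin

text \<open>
  The discrete Faraday law \<open>(D\<^sub>t B, C) + (curl E, C) = 0\<close> holds strongly. Since the complex maps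
  curls of discrete fields into \<open>Vdiv\<close>, the residual \<open>D\<^sub>t B + curl E\<close> is itself an admissible test
  field \<open>C\<close>, so its norm vanishes (\<open>discrete_Faraday_law_ae\<close>). Hence one time step changes \<open>B\<close> by a
  multiple of a discrete curl, whose divergence vanishes in the complex, and the claim follows by
  induction on the step.

  What remains is that the weak divergence of \<open>B\<^sup>n\<^sup>+\<^sup>1 = B\<^sup>n - \<Delta>t curl E\<close> vanishes if those of both
  terms do. This is not immediate, because \<open>weak_div\<close> picks one of the weak divergences and linearity
  is therefore a question of their uniqueness (\<open>weak_div_Faraday_step\<close>). The vanishing
  normal trace makes a direct argument possible: Green's formula on \<open>H0_div\<close> holds for every smooth
  function on the whole space, in particular for polynomials \<open>p\<close>, and transfers the relation between
  the fields to \<open>(weak_div B\<^sup>n\<^sup>+\<^sup>1, p) = 0\<close>. As polynomials are dense in \<open>L\<^sup>2\<close> of a bounded open set,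
  a square integrable function orthogonal to all of them is zero
  (\<open>orthogonal_to_polynomials_imp_ae_eq_0\<close>).
\<close>

section \<open>Polynomials are smooth\<close>

text \<open>
  The directional derivatives have to be polynomials again, in order that the recursion in \<open>Ck\<close> can
  be followed by induction.
\<close>

lemma polynomial_has_polynomial_derivative:
  fixes p :: "'a::real_normed_vector \<Rightarrow> real"
  assumes "real_polynomial_function p"
  shows "\<exists>p'. (\<forall>x. (p has_derivative p' x) (at x)) \<and> (\<forall>v. real_polynomial_function (\<lambda>x. p' x v))"
  using assms
proof induction
  case (linear f)
  then show ?case
    by (intro exI[of _ "\<lambda>x. f"]) (auto intro: bounded_linear_imp_has_derivative)
next
  case (const c)
  show ?case
    by (intro exI[of _ "\<lambda>x v. 0"]) auto
next
  case (add f g)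
  then obtain f' g' where
    "\<forall>x. (f has_derivative f' x) (at x)" "\<forall>v. real_polynomial_function (\<lambda>x. f' x v)"
    "\<forall>x. (g has_derivative g' x) (at x)" "\<forall>v. real_polynomial_function (\<lambda>x. g' x v)"
    by blast
  then show ?case
    by (intro exI[of _ "\<lambda>x v. f' x v + g' x v"]) (auto intro!: derivative_intros)
next
  case (mult f g)
  then obtain f' g' where
    "\<forall>x. (f has_derivative f' x) (at x)" "\<forall>v. real_polynomial_function (\<lambda>x. f' x v)"
    "\<forall>x. (g has_derivative g' x) (at x)" "\<forall>v. real_polynomial_function (\<lambda>x. g' x v)"
    by blast
  with mult.hyps show ?case
    by (intro exI[of _ "\<lambda>x v. f x * g' x v + f' x v * g x"] conjI allI has_derivative_mult
        real_polynomial_function.intros(3,4)) blast+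
qed

lemma Ck_real_polynomial_function: "real_polynomial_function p \<Longrightarrow> Ck k p"
proof (induction k arbitrary: p)
  case 0
  then show ?case
    by (auto intro: continuous_at_imp_continuous_on continuous_real_polymonial_function)
next
  case (Suc k)
  obtain p' where p': "\<forall>x. (p has_derivative p' x) (at x)"
      "\<forall>v. real_polynomial_function (\<lambda>x. p' x v)"
    using polynomial_has_polynomial_derivative[OF Suc.prems] by blast
  then have "frechet_derivative p (at x) = p' x" for x
    by (metis frechet_derivative_at)
  with p' Suc.IH show ?case
    by (auto simp: differentiable_def)
qed

lemma smooth_real_polynomial_function: "real_polynomial_function p \<Longrightarrow> smooth p"
  by (simp add: smooth_def Ck_real_polynomial_function)

lemma continuous_on_grad:
  assumes "smooth \<phi>" shows "continuous_on UNIV (grad \<phi>)"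
proof -
  have "Ck (Suc 0) \<phi>"
    using assms unfolding smooth_def by blast
  then have "continuous_on UNIV (partial i \<phi>)" for i
    by (simp add: partial_def[abs_def])
  then show ?thesis
    unfolding grad_def[abs_def] by (intro continuous_on_vec_lambda)
qed

section \<open>Square integrable functions on bounded open sets\<close>

lemma continuous_in_L2:
  fixes f :: "R3 \<Rightarrow> 'b::euclidean_space"
  assumes "open \<Omega>" "bounded \<Omega>" "continuous_on UNIV f"
  shows "f \<in> L2 \<Omega>"
proof -
  let ?M = "lebesgue_on \<Omega>"
  have meas: "\<Omega> \<in> lmeasurable"
    using assms by (intro lmeasurable_open)
  then interpret finite_measure ?M
    by (rule finite_measure_lebesgue_on)
  have f[measurable]: "f \<in> borel_measurable ?M"
    using meas assms(3)
    by (meson continuous_imp_measurable_on_sets_lebesgue continuous_on_subset fmeasurableD subset_UNIV)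
  have "compact (f ` closure \<Omega>)"
    using assms by (meson compact_closure compact_continuous_image continuous_on_subset subset_UNIV)
  then obtain K where K: "\<And>y. y \<in> f ` closure \<Omega> \<Longrightarrow> norm y \<le> K"
    using bounded_iff compact_imp_bounded by meson
  have "AE x in ?M. norm ((norm (f x))\<^sup>2) \<le> K\<^sup>2"
  proof (rule AE_I2)
    fix x assume "x \<in> space ?M"
    then have "x \<in> closure \<Omega>" using closure_subset by auto
    then show "norm ((norm (f x))\<^sup>2) \<le> K\<^sup>2"
      using K by (simp add: power_mono)
  qed
  then have "integrable ?M (\<lambda>x. (norm (f x))\<^sup>2)"
    by (intro integrable_const_bound) measurable
  then show ?thesis
    using f by (simp add: L2_def)
qed

lemma integrable_inner_L2:
  assumes "f \<in> L2 \<Omega>" "g \<in> L2 \<Omega>"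
  shows "integrable (lebesgue_on \<Omega>) (\<lambda>x. f x \<bullet> g x)"
proof (rule Bochner_Integration.integrable_bound)
  show "integrable (lebesgue_on \<Omega>) (\<lambda>x. (norm (f x))\<^sup>2 + (norm (g x))\<^sup>2)"
    using assms by (simp add: L2_def)
  show "(\<lambda>x. f x \<bullet> g x) \<in> borel_measurable (lebesgue_on \<Omega>)"
    using assms unfolding L2_def by (intro borel_measurable_inner) auto
  have "\<bar>f x \<bullet> g x\<bar> \<le> (norm (f x))\<^sup>2 + (norm (g x))\<^sup>2" for x
  proof -
    have "2 * norm (f x) * norm (g x) \<le> (norm (f x))\<^sup>2 + (norm (g x))\<^sup>2"
      by (rule sum_squares_bound)
    moreover have "\<bar>f x \<bullet> g x\<bar> \<le> norm (f x) * norm (g x)"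
      by (rule Cauchy_Schwarz_ineq2)
    moreover have "0 \<le> norm (f x) * norm (g x)" by simp
    ultimately show ?thesis by linarith
  qed
  then show "AE x in lebesgue_on \<Omega>. norm (f x \<bullet> g x) \<le> norm ((norm (f x))\<^sup>2 + (norm (g x))\<^sup>2)"
    by (intro AE_I2) (smt (verit) real_norm_def)
qed

lemma ip_self_eq_0_imp_ae_eq_0:
  assumes "f \<in> L2 \<Omega>" "ip \<Omega> f f = 0"
  shows "ae_eq \<Omega> f (\<lambda>x. 0)"
proof -
  have "AE x in lebesgue_on \<Omega>. f x \<bullet> f x = 0"
    using integrable_inner_L2[OF assms(1) assms(1)] assms(2)
    by (subst integral_nonneg_eq_0_iff_AE[symmetric]) (auto simp: ip_def)
  then show ?thesis by (simp add: ae_eq_def)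
qed

section \<open>Functions orthogonal to all polynomials\<close>

text \<open>
  By the Weierstrass theorem on the compact closure of \<open>\<Omega>\<close>, \<open>\<eta>\<close> is a uniform limit of polynomials,
  and \<open>d\<close> is integrable because \<open>\<Omega>\<close> has finite measure; so the error in the inner product is at most
  \<open>e\<close> times the \<open>L\<^sup>1\<close> norm of \<open>d\<close>.
\<close>
lemma orthogonal_to_polynomials_imp_orthogonal_to_continuous:
  fixes d \<eta> :: "R3 \<Rightarrow> real"
  assumes "open \<Omega>" "bounded \<Omega>" "d \<in> L2 \<Omega>" "continuous_on UNIV \<eta>"
    and orth: "\<And>p. real_polynomial_function p \<Longrightarrow> ip \<Omega> d p = 0"
  shows "ip \<Omega> d \<eta> = 0"
proof -
  let ?M = "lebesgue_on \<Omega>"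
  let ?I = "LINT x|?M. \<bar>d x\<bar>"
  have contL2: "p \<in> L2 \<Omega>" if "continuous_on UNIV p" for p :: "R3 \<Rightarrow> real"
    using continuous_in_L2 assms that by blast
  have "integrable ?M (\<lambda>x. d x \<bullet> (1::real))"
    by (rule integrable_inner_L2) (auto intro: assms contL2)
  then have int: "integrable ?M (\<lambda>x. \<bar>d x\<bar>)"
    by simp
  have bound: "\<bar>ip \<Omega> d \<eta>\<bar> \<le> e * ?I" if "0 < e" for e
  proof -
    have "compact (closure \<Omega>)" "continuous_on (closure \<Omega>) \<eta>"
      using assms by (auto intro: continuous_on_subset)
    then obtain p where p: "real_polynomial_function p" "\<And>x. x \<in> closure \<Omega> \<Longrightarrow> \<bar>\<eta> x - p x\<bar> < e"
      using Stone_Weierstrass_real_polynomial_function \<open>0 < e\<close> by metis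
    have "continuous_on UNIV p"
      using p by (auto intro: continuous_at_imp_continuous_on continuous_real_polymonial_function)
    then have ints: "integrable ?M (\<lambda>x. d x \<bullet> \<eta> x)" "integrable ?M (\<lambda>x. d x \<bullet> p x)"
      by (intro integrable_inner_L2 contL2 assms \<open>continuous_on UNIV p\<close>)+
    have "ip \<Omega> d \<eta> = ip \<Omega> d \<eta> - ip \<Omega> d p"
      using orth p by simp
    also have "\<dots> = (LINT x|?M. d x * (\<eta> x - p x))"
      using ints by (simp add: ip_def right_diff_distrib)
    finally have "\<bar>ip \<Omega> d \<eta>\<bar> = norm (LINT x|?M. d x * (\<eta> x - p x))"
      by simp
    also have "\<dots> \<le> (LINT x|?M. norm (d x * (\<eta> x - p x)))"
      by (rule integral_norm_bound)
    also have "\<dots> \<le> (LINT x|?M. e * \<bar>d x\<bar>)"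
    proof (rule integral_mono)
      show "integrable ?M (\<lambda>x. norm (d x * (\<eta> x - p x)))"
        using ints by (auto simp: right_diff_distrib)
      fix x assume "x \<in> space ?M"
      then have "x \<in> closure \<Omega>" using closure_subset by auto
      then show "norm (d x * (\<eta> x - p x)) \<le> e * \<bar>d x\<bar>"
        using mult_left_mono[of "\<bar>\<eta> x - p x\<bar>" e "\<bar>d x\<bar>"] p(2)[of x]
        by (simp add: abs_mult mult.commute)
    qed (use int in auto)
    finally show ?thesis by simp
  qed
  have "0 \<le> ?I" by simp
  have shrink: "e / (i + 1) * i \<le> e" if "0 \<le> i" "0 < e" for i e :: real
    using that by (simp add: field_simps)
  have "\<bar>ip \<Omega> d \<eta>\<bar> \<le> e" if "0 < e" for e
  proof -
    \<comment> \<open>The summand \<open>1\<close> keeps the denominator positive if \<open>d\<close> vanishes.\<close>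
    have "\<bar>ip \<Omega> d \<eta>\<bar> \<le> e / (?I + 1) * ?I"
      using bound[of "e / (?I + 1)"] that \<open>0 \<le> ?I\<close> by simp
    also have "\<dots> \<le> e"
      by (rule shrink[OF \<open>0 \<le> ?I\<close> that])
    finally show ?thesis .
  qed
  then have "\<bar>ip \<Omega> d \<eta>\<bar> \<le> 0"
    by (rule field_le_epsilon) simp
  then show ?thesis by simp
qed

text \<open>
  The sign of \<open>d\<close>, being measurable, is an almost everywhere limit of continuous functions, which
  may be truncated to \<open>[-1, 1]\<close> without disturbing the limit. Their inner products with \<open>d\<close> vanish
  and converge, dominated by \<open>\<bar>d\<bar>\<close>, to the integral of \<open>d sgn d = \<bar>d\<bar>\<close>.
\<close>
lemma orthogonal_to_polynomials_imp_ae_eq_0: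
  fixes d :: "R3 \<Rightarrow> real"
  assumes "open \<Omega>" "bounded \<Omega>" "d \<in> L2 \<Omega>"
    and orth: "\<And>p. real_polynomial_function p \<Longrightarrow> ip \<Omega> d p = 0"
  shows "ae_eq \<Omega> d (\<lambda>x. 0)"
proof -
  let ?M = "lebesgue_on \<Omega>"
  have d[measurable]: "d \<in> borel_measurable ?M"
    using assms by (simp add: L2_def)
  have "(\<lambda>x. 1::real) \<in> L2 \<Omega>"
    using assms by (intro continuous_in_L2) auto
  from integrable_inner_L2[OF \<open>d \<in> L2 \<Omega>\<close> this] have int: "integrable ?M d"
    by simp
  have \<Omega>: "\<Omega> \<in> sets lebesgue"
    using assms by (intro fmeasurableD lmeasurable_open)
  have "(\<lambda>x. sgn (d x)) \<in> borel_measurable ?M"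
    by measurable
  then have "(\<lambda>x. sgn (d x)) measurable_on \<Omega>"
    using \<Omega> by (simp add: measurable_on_iff_borel_measurable)
  then obtain N g where N: "negligible N"
      and g: "\<And>n::nat. continuous_on UNIV (g n)"
      and lim: "\<And>x. x \<notin> N \<Longrightarrow> (\<lambda>n. g n x) \<longlonglongrightarrow> (if x \<in> \<Omega> then sgn (d x) else 0)"
    unfolding measurable_on_def by blast
  define h where "h n x = max (-1) (min 1 (g n x))" for n x
  have h: "continuous_on UNIV (h n)" for n
    unfolding h_def using g by (intro continuous_intros)
  have hM: "h n \<in> borel_measurable ?M" for n
    using continuous_in_L2[OF assms(1,2) h] by (simp add: L2_def)
  have "AE x in lebesgue. x \<notin> N"
    using N by (simp add: AE_not_in negligible_iff_null_sets)
  then have notN: "AE x in ?M. x \<notin> N"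
    using \<Omega> by (simp add: AE_restrict_space_iff eventually_mono)
  have "(\<lambda>n. LINT x|?M. d x * h n x) \<longlonglongrightarrow> (LINT x|?M. \<bar>d x\<bar>)"
  proof (rule integral_dominated_convergence[where w = "\<lambda>x. \<bar>d x\<bar>"])
    show "AE x in ?M. (\<lambda>n. d x * h n x) \<longlonglongrightarrow> \<bar>d x\<bar>"
      using notN AE_space
    proof eventually_elim
      case (elim x)
      then have "(\<lambda>n. g n x) \<longlonglongrightarrow> sgn (d x)"
        using lim[of x] by simp
      then have "(\<lambda>n. d x * h n x) \<longlonglongrightarrow> d x * max (-1) (min 1 (sgn (d x)))"
        unfolding h_def by (intro tendsto_intros)
      also have "d x * max (-1) (min 1 (sgn (d x))) = \<bar>d x\<bar>"
        by (simp add: sgn_real_def)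
      finally show ?case .
    qed
    have "\<bar>h n x\<bar> \<le> 1" for n x
      by (auto simp: h_def)
    then show "AE x in ?M. norm (d x * h n x) \<le> \<bar>d x\<bar>" for n
      by (simp add: abs_mult mult_left_le)
    show "(\<lambda>x. d x * h n x) \<in> borel_measurable ?M" for n
      using hM by measurable
  qed (use int in auto)
  moreover have "(LINT x|?M. d x * h n x) = 0" for n
    using orthogonal_to_polynomials_imp_orthogonal_to_continuous[OF assms(1-3) h orth]
    by (simp add: ip_def)
  ultimately have "(LINT x|?M. \<bar>d x\<bar>) = 0"
    using LIMSEQ_unique[OF tendsto_const] by force
  then show ?thesis
    using int by (simp add: ae_eq_def integral_nonneg_eq_0_iff_AE)
qed

section \<open>Weak divergence and the Faraday law\<close>

text \<open>
  The vanishing normal trace admits every smooth \<open>\<phi>\<close> here, not only those with compact support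
  in \<open>\<Omega>\<close>.
\<close>
lemma weak_div_Green:
  assumes "w \<in> H0_div \<Omega>" "smooth \<phi>"
  shows "ip \<Omega> (weak_div \<Omega> w) \<phi> = - ip \<Omega> w (grad \<phi>)"
  using assms by (auto simp: H0_div_def normal_trace_def)

lemma ip_add_left:
  assumes "f \<in> L2 \<Omega>" "g \<in> L2 \<Omega>" "h \<in> L2 \<Omega>"
  shows "ip \<Omega> (\<lambda>x. f x + g x) h = ip \<Omega> f h + ip \<Omega> g h"
  using assms by (simp add: ip_def inner_add_left integrable_inner_L2)

text \<open>The residual belongs to the space of test fields, hence is orthogonal to itself.\<close>
lemma discrete_Faraday_law_ae:
  assumes V: "fe_space \<Omega> \<T> W V" "W \<subseteq> L2 \<Omega>"
    and B: "B0 \<in> V" "B1 \<in> V" and w: "w \<in> V"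
    and weak: "\<And>C. C \<in> V \<Longrightarrow> ip \<Omega> (\<lambda>x. (B1 x - B0 x) /\<^sub>R \<Delta>t) C + ip \<Omega> w C = 0"
  shows "ae_eq \<Omega> (\<lambda>x. (B1 x - B0 x) /\<^sub>R \<Delta>t + w x) (\<lambda>x. 0)"
proof -
  have add: "\<And>a b. a \<in> V \<Longrightarrow> b \<in> V \<Longrightarrow> (\<lambda>x. a x + b x) \<in> V"
    and scale: "\<And>r a. a \<in> V \<Longrightarrow> (\<lambda>x. r *\<^sub>R a x) \<in> V"
    using V(1) unfolding fe_space_def by blast+
  have sub: "V \<subseteq> L2 \<Omega>"
    using V unfolding fe_space_def by blast
  have "(\<lambda>x. (B1 x + (-1) *\<^sub>R B0 x) /\<^sub>R \<Delta>t) \<in> V"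
    by (intro add scale B)
  then have D: "(\<lambda>x. (B1 x - B0 x) /\<^sub>R \<Delta>t) \<in> V"
    by simp
  let ?C = "\<lambda>x. (B1 x - B0 x) /\<^sub>R \<Delta>t + w x"
  have C: "?C \<in> V"
    by (intro add D w)
  have "ip \<Omega> ?C ?C = ip \<Omega> (\<lambda>x. (B1 x - B0 x) /\<^sub>R \<Delta>t) ?C + ip \<Omega> w ?C"
    using sub D w C by (intro ip_add_left) auto
  then have "ip \<Omega> ?C ?C = 0"
    using weak[OF C] by simp
  then show ?thesis
    using C sub by (intro ip_self_eq_0_imp_ae_eq_0) auto
qed

lemma H0_div_subset_L2: "H0_div \<Omega> \<subseteq> L2 \<Omega>"
  by (auto simp: H0_div_def H_div_def)

lemma weak_div_in_L2:
  assumes "w \<in> H0_div \<Omega>"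
  shows "weak_div \<Omega> w \<in> L2 \<Omega>"
proof -
  have "\<exists>d. d \<in> L2 \<Omega> \<and> has_weak_div \<Omega> w d"
    using assms unfolding H0_div_def H_div_def by blast
  from someI_ex[OF this] show ?thesis
    by (simp add: weak_div_def)
qed

text \<open>
  By Green's formula, a vanishing divergence of \<open>B0\<close> and \<open>w\<close> makes both orthogonal to gradients of
  polynomials. The Faraday relation passes this on to \<open>B1\<close>, and Green's formula read backwards makes
  the divergence of \<open>B1\<close> orthogonal to all polynomials.
\<close>
lemma weak_div_Faraday_step:
  assumes \<Omega>: "open \<Omega>" "bounded \<Omega>"
    and H: "B0 \<in> H0_div \<Omega>" "B1 \<in> H0_div \<Omega>" "w \<in> H0_div \<Omega>"
    and "\<Delta>t \<noteq> 0" and ae: "ae_eq \<Omega> (\<lambda>x. (B1 x - B0 x) /\<^sub>R \<Delta>t + w x) (\<lambda>x. 0)"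
    and div0: "ae_eq \<Omega> (weak_div \<Omega> B0) (\<lambda>x. 0)" "ae_eq \<Omega> (weak_div \<Omega> w) (\<lambda>x. 0)"
  shows "ae_eq \<Omega> (weak_div \<Omega> B1) (\<lambda>x. 0)"
proof (rule orthogonal_to_polynomials_imp_ae_eq_0[OF \<Omega> weak_div_in_L2])
  fix p :: "R3 \<Rightarrow> real"
  assume "real_polynomial_function p"
  then have p: "smooth p"
    by (rule smooth_real_polynomial_function)
  have grad: "grad p \<in> L2 \<Omega>"
    by (intro continuous_in_L2 \<Omega> continuous_on_grad p)
  have zero: "ip \<Omega> v (grad p) = 0" if "v \<in> H0_div \<Omega>" "ae_eq \<Omega> (weak_div \<Omega> v) (\<lambda>x. 0)" for v
  proof -
    have "ip \<Omega> (weak_div \<Omega> v) p = 0"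
      using that(2) unfolding ip_def ae_eq_def by (intro integral_eq_zero_AE) auto
    then show ?thesis
      using weak_div_Green[OF that(1) p] by simp
  qed
  have L2: "B0 \<in> L2 \<Omega>" "B1 \<in> L2 \<Omega>" "w \<in> L2 \<Omega>"
    using H H0_div_subset_L2 by blast+
  have "ae_eq \<Omega> B1 (\<lambda>x. B0 x + (- \<Delta>t) *\<^sub>R w x)"
    using ae unfolding ae_eq_def
  proof eventually_elim
    case (elim x)
    then have "\<Delta>t *\<^sub>R ((B1 x - B0 x) /\<^sub>R \<Delta>t + w x) = 0"
      by simp
    then show ?case
      using \<open>\<Delta>t \<noteq> 0\<close> by (simp add: scaleR_add_right algebra_simps)
  qed
  then have "ip \<Omega> B1 (grad p) = ip \<Omega> (\<lambda>x. B0 x + (- \<Delta>t) *\<^sub>R w x) (grad p)"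
    unfolding ip_def ae_eq_def using L2 grad
    by (intro integral_cong_AE borel_measurable_inner) (auto simp: L2_def)
  also have "\<dots> = ip \<Omega> B0 (grad p) - \<Delta>t * ip \<Omega> w (grad p)"
    using integrable_inner_L2[OF L2(1) grad] integrable_inner_L2[OF L2(3) grad]
    by (simp add: ip_def inner_diff_left)
  finally have "ip \<Omega> B1 (grad p) = 0"
    using zero H div0 by simp
  then show "ip \<Omega> (weak_div \<Omega> B1) p = 0"
    using weak_div_Green[OF H(2) p] by simp
qed (use H in auto)

theorem theorem3:
  fixes \<Omega> :: "(real^3) set" and \<T> :: "(real^3) set set"
    and Vgrad V0 :: "(real^3 \<Rightarrow> real) set" and Vcurl Vdiv :: "(real^3 \<Rightarrow> real^3) set"
    and \<Delta>t c :: real and R\<^sub>e R\<^sub>m :: ereal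
    and f :: "real \<Rightarrow> real^3 \<Rightarrow> real^3"
    and u B \<omega> j E H :: "nat \<Rightarrow> real^3 \<Rightarrow> real^3" and P :: "nat \<Rightarrow> real^3 \<Rightarrow> real"
  assumes "lipschitz_domain \<Omega>" and "bounded \<Omega>" and "contractible \<Omega>"
    and "mesh \<Omega> \<T>"
    and "exact_discrete_de_rham \<Omega> \<T> Vgrad Vcurl Vdiv V0"
    and "0 < \<Delta>t" and "0 < c" and "0 < R\<^sub>e" and "0 < R\<^sub>m"
    and "\<And>t. 0 \<le> t \<Longrightarrow> f t \<in> L2 \<Omega>"
    and "mhd_solution \<Omega> Vgrad Vcurl Vdiv \<Delta>t c R\<^sub>e R\<^sub>m f u B \<omega> j E H P"
    and "ae_eq \<Omega> (weak_div \<Omega> (B 0)) (\<lambda>x. 0)"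
  shows "\<forall>n. ae_eq \<Omega> (weak_div \<Omega> (B n)) (\<lambda>x. 0)"
proof
  fix n
  have "open \<Omega>"
    using assms(1) by (simp add: lipschitz_domain_def)
  have div: "fe_space \<Omega> \<T> (H0_div \<Omega>) Vdiv"
    and curl: "\<And>v. v \<in> Vcurl \<Longrightarrow> weak_curl \<Omega> v \<in> Vdiv"
    and exact: "\<And>w. w \<in> Vdiv \<Longrightarrow>
      ae_eq \<Omega> (weak_div \<Omega> w) (\<lambda>x. 0) \<longleftrightarrow> (\<exists>v\<in>Vcurl. ae_eq \<Omega> w (weak_curl \<Omega> v))"
    using assms(5) unfolding exact_discrete_de_rham_def by blast+
  have sub: "Vdiv \<subseteq> H0_div \<Omega>"
    using div by (simp add: fe_space_def)
  \<comment> \<open>A discrete curl is divergence free: take the field itself as the potential in \<open>exact\<close>.\<close>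
  have div_curl: "ae_eq \<Omega> (weak_div \<Omega> (weak_curl \<Omega> v)) (\<lambda>x. 0)" if "v \<in> Vcurl" for v
    using exact[OF curl[OF that]] that by (auto simp: ae_eq_def)
  have B: "B k \<in> Vdiv" and E: "E k \<in> Vcurl"
    and Faraday: "\<And>C. C \<in> Vdiv \<Longrightarrow>
      ip \<Omega> (\<lambda>x. (B (Suc k) x - B k x) /\<^sub>R \<Delta>t) C + ip \<Omega> (weak_curl \<Omega> (E k)) C = 0" for k
    using assms(11) unfolding mhd_solution_def mhd_step_def Let_def by blast+
  show "ae_eq \<Omega> (weak_div \<Omega> (B n)) (\<lambda>x. 0)"
  proof (induction n)
    case 0
    show ?case by (rule assms(12))
  next
    case (Suc n)
    have "ae_eq \<Omega> (\<lambda>x. (B (Suc n) x - B n x) /\<^sub>R \<Delta>t + weak_curl \<Omega> (E n) x) (\<lambda>x. 0)"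
      by (rule discrete_Faraday_law_ae[OF div H0_div_subset_L2 B B curl[OF E] Faraday])
    with Suc show ?case
      using \<open>0 < \<Delta>t\<close> sub B[of n] B[of "Suc n"] curl[OF E[of n]] div_curl[OF E[of n]]
        \<open>open \<Omega>\<close> \<open>bounded \<Omega>\<close>
      by (intro weak_div_Faraday_step[of \<Omega> "B n" "B (Suc n)" "weak_curl \<Omega> (E n)" \<Delta>t]) auto
  qed
qed

end
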